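(* Let $M$ be a monoid, let $A$ be an $M$-act defined by a presentation $\langle X\,|\,R\rangle$, and let $B$ be a subact of $A$ generated by a set $Y\subseteq B$. For each $y\in Y$ choose $w_y\in F_X$ which represents $y$. Let $\psi:F_Y\to F_X$ be the unique $M$-homomorphism with $y\psi=w_y$ for all $y\in Y$. Let $L(X,B)$ be the set of all elements of $F_X$ which represent elements of $B$, and let $\phi:L(X,B)\to F_Y$ be any map such that $(w\phi)\psi=w$ holds in $A$ for all $w\in L(X,B)$. Define the following sets of relations on $F_Y$: $$R_1=\{y=w_y\phi : y\in Y\},$$ $$R_2=\{(wm)\phi=(w\phi)m : w\in L(X,B),\ m\in M\},$$ $$R_3=\{(um)\phi=(vm)\phi : (u,v)\in R,\ m\in M,\ um\in L(X,B)\}.$$ Then $B$ is defined by the presentation $\langle Y\,|\,R_1\cup R_2\cup R_3\rangle$.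
   Context: Let $M$ be a monoid with identity $1$. A (right) $M$-act is a non-empty set $A$ with a map $A\times M\to A$, $(a,m)\mapsto am$, with $a(mn)=(am)n$ and $a1=a$. A subact of $A$ is a non-empty subset $B$ with $bm\in B$ for all $b\in B$, $m\in M$. A subset $U$ generates $A$ if every $a\in A$ is $um$ for some $u\in U$, $m\in M$. An $M$-homomorphism is a map $\theta$ (written on the right) between $M$-acts with $(am)\theta=(a\theta)m$. A congruence on $A$ is an equivalence relation $\rho$ with $(a,b)\in\rho\Rightarrow(am,bm)\in\rho$ for all $m\in M$. For a set $X$, $F_X=X\times M$ is the free $M$-act with $(x,m)n=(x,mn)$; one writes $x\cdot m$ for $(x,m)$ and $x$ for $(x,1)$. A presentation $\langle X\,|\,R\rangle$ consists of a non-empty set $X$ and a set $R\subseteq F_X\times F_X$ of relations; $(u,v)\in R$ is also written $u=v$. An $M$-act $A$ is defined by $\langle X\,|\,R\rangle$ if $A\cong F_X/\rho$, where $\rho$ is the smallest congruence on $F_X$ containing $R$. Fixing such an isomorphism, $w\in F_X$ represents $a\in A$ if $a$ corresponds to the class $[w]_\rho$; "$w_1=w_2$ holds in $A$" means that $w_1,w_2\in F_X$ represent the same element of $A$. *)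

theory Defs
  imports "HOL-Algebra.Group"
begin

section \<open>Acts over a monoid\<close>

record ('a, 'm) act = "'a partial_object" +
  action :: "'a \<Rightarrow> 'm \<Rightarrow> 'a" (infixl "\<cdot>\<index>" 70)

locale monoid_act = monoid M for M (structure) +
  fixes A :: "('a, 'm) act"
  assumes nonempty: "carrier A \<noteq> {}"
    and act_closed: "\<lbrakk>a \<in> carrier A; m \<in> carrier M\<rbrakk> \<Longrightarrow> a \<cdot>\<^bsub>A\<^esub> m \<in> carrier A"
    and act_mult: "\<lbrakk>a \<in> carrier A; m \<in> carrier M; n \<in> carrier M\<rbrakk>
                    \<Longrightarrow> a \<cdot>\<^bsub>A\<^esub> (m \<otimes> n) = (a \<cdot>\<^bsub>A\<^esub> m) \<cdot>\<^bsub>A\<^esub> n"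
    and act_one: "a \<in> carrier A \<Longrightarrow> a \<cdot>\<^bsub>A\<^esub> \<one> = a"

definition subact :: "('m, 'z) monoid_scheme \<Rightarrow> ('a, 'm) act \<Rightarrow> 'a set \<Rightarrow> bool" where
  "subact M A B \<longleftrightarrow> B \<noteq> {} \<and> B \<subseteq> carrier A \<and> (\<forall>b\<in>B. \<forall>m\<in>carrier M. b \<cdot>\<^bsub>A\<^esub> m \<in> B)"

definition generates :: "('m, 'z) monoid_scheme \<Rightarrow> ('a, 'm) act \<Rightarrow> 'a set \<Rightarrow> bool" where
  "generates M A U \<longleftrightarrow>
     U \<subseteq> carrier A \<and> (\<forall>a\<in>carrier A. \<exists>u\<in>U. \<exists>m\<in>carrier M. a = u \<cdot>\<^bsub>A\<^esub> m)"

definition act_hom :: "('m, 'z) monoid_scheme \<Rightarrow> ('a, 'm) act \<Rightarrow> ('b, 'm) act \<Rightarrow> ('a \<Rightarrow> 'b) set" where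
  "act_hom M A B = {f. f \<in> carrier A \<rightarrow> carrier B \<and>
     (\<forall>a\<in>carrier A. \<forall>m\<in>carrier M. f (a \<cdot>\<^bsub>A\<^esub> m) = f a \<cdot>\<^bsub>B\<^esub> m)}"

definition act_iso :: "('m, 'z) monoid_scheme \<Rightarrow> ('a, 'm) act \<Rightarrow> ('b, 'm) act \<Rightarrow> ('a \<Rightarrow> 'b) set" where
  "act_iso M A B = {f \<in> act_hom M A B. bij_betw f (carrier A) (carrier B)}"

definition act_congruence :: "('m, 'z) monoid_scheme \<Rightarrow> ('a, 'm) act \<Rightarrow> ('a \<times> 'a) set \<Rightarrow> bool" where
  "act_congruence M A \<rho> \<longleftrightarrow> equiv (carrier A) \<rho> \<and>
     (\<forall>a b. \<forall>m\<in>carrier M. (a, b) \<in> \<rho> \<longrightarrow> (a \<cdot>\<^bsub>A\<^esub> m, b \<cdot>\<^bsub>A\<^esub> m) \<in> \<rho>)"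

definition generated_congruence ::
    "('m, 'z) monoid_scheme \<Rightarrow> ('a, 'm) act \<Rightarrow> ('a \<times> 'a) set \<Rightarrow> ('a \<times> 'a) set" where
  "generated_congruence M A R = \<Inter>{\<rho>. act_congruence M A \<rho> \<and> R \<subseteq> \<rho>}"

text \<open>On classes of a congruence the union below is a single class; see
  \<open>quotient_act_class\<close>.\<close>

definition quotient_act :: "('a, 'm) act \<Rightarrow> ('a \<times> 'a) set \<Rightarrow> ('a set, 'm) act" where
  "quotient_act A \<rho> =
     \<lparr>carrier = carrier A // \<rho>, action = (\<lambda>C m. \<Union>a\<in>C. \<rho> `` {a \<cdot>\<^bsub>A\<^esub> m})\<rparr>"


section \<open>Free acts and presentations\<close>

definition free_act :: "('m, 'z) monoid_scheme \<Rightarrow> 'x set \<Rightarrow> ('x \<times> 'm, 'm) act" where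
  "free_act M X =
     \<lparr>carrier = X \<times> carrier M, action = (\<lambda>w n. (fst w, snd w \<otimes>\<^bsub>M\<^esub> n))\<rparr>"

definition free_gen :: "('m, 'z) monoid_scheme \<Rightarrow> 'x \<Rightarrow> 'x \<times> 'm" where
  "free_gen M x = (x, \<one>\<^bsub>M\<^esub>)"

definition presentation ::
    "('m, 'z) monoid_scheme \<Rightarrow> 'x set \<Rightarrow> (('x \<times> 'm) \<times> ('x \<times> 'm)) set \<Rightarrow> bool" where
  "presentation M X R \<longleftrightarrow>
     X \<noteq> {} \<and> R \<subseteq> carrier (free_act M X) \<times> carrier (free_act M X)"

abbreviation pres_congruence ::
    "('m, 'z) monoid_scheme \<Rightarrow> 'x set \<Rightarrow> (('x \<times> 'm) \<times> ('x \<times> 'm)) set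
      \<Rightarrow> (('x \<times> 'm) \<times> ('x \<times> 'm)) set" where
  "pres_congruence M X R \<equiv> generated_congruence M (free_act M X) R"

definition presented_act ::
    "('m, 'z) monoid_scheme \<Rightarrow> 'x set \<Rightarrow> (('x \<times> 'm) \<times> ('x \<times> 'm)) set
      \<Rightarrow> (('x \<times> 'm) set, 'm) act" where
  "presented_act M X R = quotient_act (free_act M X) (pres_congruence M X R)"

text \<open>The isomorphism \<open>\<theta>\<close> from the presented act onto \<open>A\<close> is kept explicit, because
  which words represent which elements of \<open>A\<close> depends on it.\<close>

definition defined_via ::
    "('m, 'z) monoid_scheme \<Rightarrow> ('a, 'm) act \<Rightarrow> 'x set \<Rightarrow> (('x \<times> 'm) \<times> ('x \<times> 'm)) set
      \<Rightarrow> (('x \<times> 'm) set \<Rightarrow> 'a) \<Rightarrow> bool" where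
  "defined_via M A X R \<theta> \<longleftrightarrow>
     presentation M X R \<and> \<theta> \<in> act_iso M (presented_act M X R) A"

definition defined_by ::
    "('m, 'z) monoid_scheme \<Rightarrow> ('a, 'm) act \<Rightarrow> 'x set \<Rightarrow> (('x \<times> 'm) \<times> ('x \<times> 'm)) set \<Rightarrow> bool" where
  "defined_by M A X R \<longleftrightarrow> (\<exists>\<theta>. defined_via M A X R \<theta>)"

definition represents ::
    "('m, 'z) monoid_scheme \<Rightarrow> 'x set \<Rightarrow> (('x \<times> 'm) \<times> ('x \<times> 'm)) set
      \<Rightarrow> (('x \<times> 'm) set \<Rightarrow> 'a) \<Rightarrow> 'x \<times> 'm \<Rightarrow> 'a \<Rightarrow> bool" where
  "represents M X R \<theta> w a \<longleftrightarrow>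
     w \<in> carrier (free_act M X) \<and> \<theta> (pres_congruence M X R `` {w}) = a"

definition holds_in ::
    "('m, 'z) monoid_scheme \<Rightarrow> 'x set \<Rightarrow> (('x \<times> 'm) \<times> ('x \<times> 'm)) set
      \<Rightarrow> (('x \<times> 'm) set \<Rightarrow> 'a) \<Rightarrow> 'x \<times> 'm \<Rightarrow> 'x \<times> 'm \<Rightarrow> bool" where
  "holds_in M X R \<theta> w1 w2 \<longleftrightarrow> (\<exists>a. represents M X R \<theta> w1 a \<and> represents M X R \<theta> w2 a)"

definition rep_words ::
    "('m, 'z) monoid_scheme \<Rightarrow> 'x set \<Rightarrow> (('x \<times> 'm) \<times> ('x \<times> 'm)) set
      \<Rightarrow> (('x \<times> 'm) set \<Rightarrow> 'a) \<Rightarrow> 'a set \<Rightarrow> ('x \<times> 'm) set" where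
  "rep_words M X R \<theta> B = {w \<in> carrier (free_act M X). \<exists>b\<in>B. represents M X R \<theta> w b}"


section \<open>Well-definedness of the constructions\<close>

lemma monoid_act_free_act:
  assumes "monoid M" "X \<noteq> {}"
  shows "monoid_act M (free_act M X)"
proof -
  interpret monoid M by fact
  show ?thesis
    using assms(2) by unfold_locales (auto simp: free_act_def m_assoc)
qed

lemma monoid_act_subact:
  assumes "monoid_act M A" "subact M A B"
  shows "monoid_act M (A\<lparr>carrier := B\<rparr>)"
proof -
  interpret monoid_act M A by fact
  show ?thesis
    using assms(2) by unfold_locales (auto simp: subact_def act_mult act_one subset_iff)
qed

lemma (in monoid_act) act_congruence_generated:
  assumes "R \<subseteq> carrier A \<times> carrier A"
  shows "act_congruence M A (generated_congruence M A R)"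
    and "R \<subseteq> generated_congruence M A R"
proof -
  let ?S = "{\<rho>. act_congruence M A \<rho> \<and> R \<subseteq> \<rho>}"
  have "act_congruence M A (carrier A \<times> carrier A)"
    by (auto simp: act_congruence_def act_closed intro!: equivI refl_onI symI transI)
  then have full: "carrier A \<times> carrier A \<in> ?S"
    using assms by simp
  have eq: "equiv (carrier A) \<rho>" if "\<rho> \<in> ?S" for \<rho>
    using that by (simp add: act_congruence_def)
  have "equiv (carrier A) (\<Inter>?S)"
  proof (rule equivI)
    show "\<Inter>?S \<subseteq> carrier A \<times> carrier A"
      using full by (rule Inter_lower)
    show "refl_on (carrier A) (\<Inter>?S)"
      using eq by (auto simp: equiv_def refl_on_def)
    show "sym (\<Inter>?S)"
      using eq unfolding equiv_def sym_def by blast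
    show "trans (\<Inter>?S)"
      using eq unfolding equiv_def trans_def by blast
  qed
  then show "act_congruence M A (generated_congruence M A R)"
    by (auto simp: act_congruence_def generated_congruence_def)
  show "R \<subseteq> generated_congruence M A R"
    by (auto simp: generated_congruence_def)
qed

lemma quotient_act_class:
  assumes "act_congruence M A \<rho>" "a \<in> carrier A" "m \<in> carrier M"
  shows "(\<rho> `` {a}) \<cdot>\<^bsub>quotient_act A \<rho>\<^esub> m = \<rho> `` {a \<cdot>\<^bsub>A\<^esub> m}"
proof -
  have eq: "equiv (carrier A) \<rho>"
    using assms(1) by (simp add: act_congruence_def)
  have "\<rho> `` {b \<cdot>\<^bsub>A\<^esub> m} = \<rho> `` {a \<cdot>\<^bsub>A\<^esub> m}" if "b \<in> \<rho> `` {a}" for b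
  proof -
    have "(a \<cdot>\<^bsub>A\<^esub> m, b \<cdot>\<^bsub>A\<^esub> m) \<in> \<rho>"
      using that assms(1,3) unfolding act_congruence_def by blast
    then show ?thesis
      using equiv_class_eq[OF eq] by metis
  qed
  moreover have "a \<in> \<rho> `` {a}"
    using equiv_class_self[OF eq assms(2)] .
  ultimately have "(\<Union>b\<in>\<rho> `` {a}. \<rho> `` {b \<cdot>\<^bsub>A\<^esub> m}) = \<rho> `` {a \<cdot>\<^bsub>A\<^esub> m}"
    by blast
  then show ?thesis
    by (simp add: quotient_act_def)
qed

lemma free_act_universal:
  assumes "monoid_act M A" "w \<in> Y \<rightarrow> carrier A"
  shows "\<exists>\<psi>\<in>act_hom M (free_act M Y) A. \<forall>y\<in>Y. \<psi> (free_gen M y) = w y"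
    and "\<lbrakk>\<psi> \<in> act_hom M (free_act M Y) A; \<forall>y\<in>Y. \<psi> (free_gen M y) = w y; y \<in> Y; m \<in> carrier M\<rbrakk>
          \<Longrightarrow> \<psi> (y, m) = w y \<cdot>\<^bsub>A\<^esub> m"
proof -
  interpret monoid_act M A by fact
  have w: "w y \<in> carrier A" if "y \<in> Y" for y
    using assms(2) that by blast
  show "\<exists>\<psi>\<in>act_hom M (free_act M Y) A. \<forall>y\<in>Y. \<psi> (free_gen M y) = w y"
    by (rule bexI[where x = "\<lambda>(y, m). w y \<cdot>\<^bsub>A\<^esub> m"])
      (auto simp: act_hom_def free_act_def free_gen_def act_one act_mult act_closed w)
  show "\<psi> (y, m) = w y \<cdot>\<^bsub>A\<^esub> m"
    if hom: "\<psi> \<in> act_hom M (free_act M Y) A" and gen: "\<forall>y\<in>Y. \<psi> (free_gen M y) = w y"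
      and y: "y \<in> Y" and m: "m \<in> carrier M"
  proof -
    have "free_gen M y \<in> carrier (free_act M Y)"
      using y by (simp add: free_gen_def free_act_def)
    then have "\<psi> (free_gen M y \<cdot>\<^bsub>free_act M Y\<^esub> m) = \<psi> (free_gen M y) \<cdot>\<^bsub>A\<^esub> m"
      using hom m by (simp add: act_hom_def)
    then show ?thesis
      using gen y m by (simp add: free_gen_def free_act_def)
  qed
qed

end

theory Submission
  imports Defs
begin

text \<open>Write \<open>\<pi>\<close> for the map sending a word over \<open>X\<close> to the element of \<open>A\<close> it represents. Then
  \<open>\<pi> \<circ> \<psi>\<close> is a homomorphism from the free act on \<open>Y\<close> onto \<open>B\<close> that respects the relations, and
  the point is that its kernel is contained in the congruence \<open>\<sigma>\<close> they generate. By \<open>R1\<close> and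
  \<open>R2\<close>, every word \<open>g\<close> over \<open>Y\<close> is \<open>\<sigma>\<close>-related to \<open>\<phi> (\<psi> g)\<close>, so it suffices that \<open>\<phi>\<close> sends words
  of \<open>L\<close> representing the same element to \<open>\<sigma>\<close>-related words. This holds because the relation
  ``for all \<open>m\<close>, \<open>um \<in> L \<longleftrightarrow> vm \<in> L\<close>, and then \<open>\<phi> (um)\<close> and \<open>\<phi> (vm)\<close> are \<open>\<sigma>\<close>-related'' is a
  congruence, which contains \<open>R\<close> by \<open>R3\<close>.\<close>

section \<open>Homomorphisms, quotients and presentations of acts\<close>

lemma generated_congruence_least:
  assumes "act_congruence M A \<rho>" "R \<subseteq> \<rho>"
  shows "generated_congruence M A R \<subseteq> \<rho>"
  using assms by (auto simp: generated_congruence_def)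

lemma act_hom_closed: "\<lbrakk>f \<in> act_hom M A B; a \<in> carrier A\<rbrakk> \<Longrightarrow> f a \<in> carrier B"
  by (auto simp: act_hom_def)

lemma act_hom_act:
  "\<lbrakk>f \<in> act_hom M A B; a \<in> carrier A; m \<in> carrier M\<rbrakk> \<Longrightarrow> f (a \<cdot>\<^bsub>A\<^esub> m) = f a \<cdot>\<^bsub>B\<^esub> m"
  by (auto simp: act_hom_def)

lemma act_hom_comp:
  assumes "f \<in> act_hom M A B" "g \<in> act_hom M B C"
  shows "g \<circ> f \<in> act_hom M A C"
  using assms by (auto simp: act_hom_def Pi_iff)

lemma (in monoid_act) act_congruence_kernel:
  assumes "f \<in> act_hom M A B"
  shows "act_congruence M A {(a, b). a \<in> carrier A \<and> b \<in> carrier A \<and> f a = f b}"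
  using assms
  by (auto simp: act_congruence_def act_closed act_hom_act intro!: equivI refl_onI symI transI)

lemma act_hom_quotient_class:
  assumes "act_congruence M A \<rho>"
  shows "(\<lambda>a. \<rho> `` {a}) \<in> act_hom M A (quotient_act A \<rho>)"
  using assms by (auto simp: act_hom_def quotient_act_class) (auto simp: quotient_act_def quotientI)

text \<open>First isomorphism theorem for acts. Since related elements have equal images,
  \<open>f\<close> maps each class to a singleton and \<open>the_elem\<close> reads off its value;
  the other direction of \<open>ker\<close> makes the induced map injective.\<close>

lemma (in monoid_act) act_iso_quotient_kernel:
  assumes f: "f \<in> act_hom M A B" and surj: "f ` carrier A = carrier B"
    and cong: "act_congruence M A \<rho>"
    and ker: "\<And>a b. \<lbrakk>a \<in> carrier A; b \<in> carrier A\<rbrakk> \<Longrightarrow> (a, b) \<in> \<rho> \<longleftrightarrow> f a = f b"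
  shows "(\<lambda>C. the_elem (f ` C)) \<in> act_iso M (quotient_act A \<rho>) B"
proof -
  let ?h = "\<lambda>C. the_elem (f ` C)"
  have eq: "equiv (carrier A) \<rho>"
    using cong by (simp add: act_congruence_def)
  have h: "?h (\<rho> `` {a}) = f a" if a: "a \<in> carrier A" for a
  proof -
    have "f ` (\<rho> `` {a}) = {f a}"
    proof (intro equalityI subsetI)
      fix c assume "c \<in> f ` (\<rho> `` {a})"
      then obtain b where b: "(a, b) \<in> \<rho>" "c = f b" by blast
      then have "b \<in> carrier A" using equiv_type[OF eq] by blast
      then show "c \<in> {f a}" using b ker[OF a, of b] by simp
    next
      fix c assume "c \<in> {f a}"
      then show "c \<in> f ` (\<rho> `` {a})" using equiv_class_self[OF eq a] by blast
    qed
    then show ?thesis by simp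
  qed
  have hom: "?h \<in> act_hom M (quotient_act A \<rho>) B"
    unfolding act_hom_def
  proof (intro CollectI conjI ballI funcsetI)
    fix C assume "C \<in> carrier (quotient_act A \<rho>)"
    then obtain a where a: "a \<in> carrier A" "C = \<rho> `` {a}"
      by (auto simp: quotient_act_def elim: quotientE)
    then show "?h C \<in> carrier B" using h act_hom_closed[OF f] by simp
    fix m assume "m \<in> carrier M"
    then show "?h (C \<cdot>\<^bsub>quotient_act A \<rho>\<^esub> m) = ?h C \<cdot>\<^bsub>B\<^esub> m"
      using a h f by (simp add: quotient_act_class[OF cong] act_closed act_hom_act)
  qed
  have "inj_on ?h (carrier A // \<rho>)"
  proof (rule inj_onI)
    fix C D assume C: "C \<in> carrier A // \<rho>" and D: "D \<in> carrier A // \<rho>" and CD: "?h C = ?h D"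
    obtain a b where "a \<in> carrier A" "C = \<rho> `` {a}" "b \<in> carrier A" "D = \<rho> `` {b}"
      using C D by (auto elim!: quotientE)
    then show "C = D" using CD h ker equiv_class_eq[OF eq] by simp
  qed
  moreover have "?h ` (carrier A // \<rho>) = carrier B"
  proof -
    \<comment> \<open>As the image of the class map, the quotient inherits surjectivity directly
      from \<open>f\<close>.\<close>
    have "carrier A // \<rho> = (\<lambda>a. \<rho> `` {a}) ` carrier A"
      by (auto simp: quotient_def)
    then show ?thesis
      by (simp add: surj[symmetric] image_image h cong: image_cong_simp)
  qed
  ultimately show ?thesis
    using hom by (simp add: act_iso_def bij_betw_def quotient_act_def)
qed

text \<open>The kernel of \<open>f\<close> is a congruence, so \<open>sound\<close> on
  \<open>R\<close> alone puts the generated congruence inside it. With \<open>complete\<close> the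
  two coincide, and the first isomorphism theorem applies.\<close>

lemma defined_by_kernelI:
  assumes M: "monoid M" and pres: "presentation M X R"
    and f: "f \<in> act_hom M (free_act M X) A" and surj: "f ` carrier (free_act M X) = carrier A"
    and sound: "\<And>u v. (u, v) \<in> R \<Longrightarrow> f u = f v"
    and complete: "\<And>u v. \<lbrakk>u \<in> carrier (free_act M X); v \<in> carrier (free_act M X); f u = f v\<rbrakk>
                     \<Longrightarrow> (u, v) \<in> pres_congruence M X R"
  shows "defined_by M A X R"
proof -
  interpret F: monoid_act M "free_act M X"
    using M pres by (simp add: monoid_act_free_act presentation_def)
  have R: "R \<subseteq> carrier (free_act M X) \<times> carrier (free_act M X)"
    using pres by (simp add: presentation_def)
  have "pres_congruence M X R
      \<subseteq> {(u, v). u \<in> carrier (free_act M X) \<and> v \<in> carrier (free_act M X) \<and> f u = f v}"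
    using R sound by (intro generated_congruence_least F.act_congruence_kernel[OF f]) auto
  then have "(u, v) \<in> pres_congruence M X R \<longleftrightarrow> f u = f v"
    if "u \<in> carrier (free_act M X)" "v \<in> carrier (free_act M X)" for u v
    using that complete by blast
  from F.act_iso_quotient_kernel[OF f surj F.act_congruence_generated(1)[OF R] this] pres
  show ?thesis
    unfolding defined_by_def defined_via_def presented_act_def by blast
qed

text \<open>Evaluation of words is the class map followed by \<open>\<theta>\<close>, hence a
  homomorphism; its kernel is the congruence of the presentation because \<open>\<theta>\<close> is
  injective on classes.\<close>

lemma defined_via_hom:
  assumes M: "monoid M" and def: "defined_via M A X R \<theta>"
  shows "(\<lambda>u. \<theta> (pres_congruence M X R `` {u})) \<in> act_hom M (free_act M X) A"
    and "\<lbrakk>u \<in> carrier (free_act M X); v \<in> carrier (free_act M X)\<rbrakk> \<Longrightarrow>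
      \<theta> (pres_congruence M X R `` {u}) = \<theta> (pres_congruence M X R `` {v})
        \<longleftrightarrow> (u, v) \<in> pres_congruence M X R"
proof -
  let ?\<rho> = "pres_congruence M X R"
  have pres: "presentation M X R" and iso: "\<theta> \<in> act_iso M (presented_act M X R) A"
    using def by (simp_all add: defined_via_def)
  interpret F: monoid_act M "free_act M X"
    using M pres by (simp add: monoid_act_free_act presentation_def)
  have cong: "act_congruence M (free_act M X) ?\<rho>"
    using pres by (simp add: presentation_def F.act_congruence_generated)
  show "(\<lambda>u. \<theta> (?\<rho> `` {u})) \<in> act_hom M (free_act M X) A"
    using act_hom_comp[OF act_hom_quotient_class[OF cong], of \<theta> A] iso
    by (simp add: act_iso_def presented_act_def comp_def)
  have inj: "inj_on \<theta> (carrier (free_act M X) // ?\<rho>)"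
    using iso by (simp add: act_iso_def presented_act_def bij_betw_def quotient_act_def)
  show "\<theta> (?\<rho> `` {u}) = \<theta> (?\<rho> `` {v}) \<longleftrightarrow> (u, v) \<in> ?\<rho>"
    if uv: "u \<in> carrier (free_act M X)" "v \<in> carrier (free_act M X)"
  proof -
    have "equiv (carrier (free_act M X)) ?\<rho>"
      using cong by (simp add: act_congruence_def)
    from eq_equiv_class_iff[OF this uv] show ?thesis
      using inj_on_eq_iff[OF inj quotientI[OF uv(1)] quotientI[OF uv(2)]] by simp
  qed
qed

theorem theorem6p1:
  fixes M :: "('m, 'z) monoid_scheme"
    and A :: "('a, 'm) act"
    and X :: "'x set"
    and R :: "(('x \<times> 'm) \<times> ('x \<times> 'm)) set"
    and \<theta> :: "('x \<times> 'm) set \<Rightarrow> 'a"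
    and B Y :: "'a set"
    and w :: "'a \<Rightarrow> 'x \<times> 'm"
    and \<psi> :: "'a \<times> 'm \<Rightarrow> 'x \<times> 'm"
    and \<phi> :: "'x \<times> 'm \<Rightarrow> 'a \<times> 'm"
    and L :: "('x \<times> 'm) set"
    and R1 R2 R3 :: "(('a \<times> 'm) \<times> ('a \<times> 'm)) set"
  assumes "monoid M"
    and "monoid_act M A"
    and "defined_via M A X R \<theta>"
    and "subact M A B"
    and "generates M (A\<lparr>carrier := B\<rparr>) Y"
    and "\<And>y. y \<in> Y \<Longrightarrow> represents M X R \<theta> (w y) y"
    and "\<psi> \<in> act_hom M (free_act M Y) (free_act M X)"
    and "\<And>y. y \<in> Y \<Longrightarrow> \<psi> (free_gen M y) = w y"
    and L_def: "L = rep_words M X R \<theta> B"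
    and "\<phi> \<in> L \<rightarrow> carrier (free_act M Y)"
    and "\<And>u. u \<in> L \<Longrightarrow> holds_in M X R \<theta> (\<psi> (\<phi> u)) u"
    and R1_def: "R1 = {(free_gen M y, \<phi> (w y)) | y. y \<in> Y}"
    and R2_def: "R2 = {(\<phi> (u \<cdot>\<^bsub>free_act M X\<^esub> m), \<phi> u \<cdot>\<^bsub>free_act M Y\<^esub> m) | u m.
                         u \<in> L \<and> m \<in> carrier M}"
    and R3_def: "R3 = {(\<phi> (u \<cdot>\<^bsub>free_act M X\<^esub> m), \<phi> (v \<cdot>\<^bsub>free_act M X\<^esub> m)) | u v m.
                         (u, v) \<in> R \<and> m \<in> carrier M \<and> u \<cdot>\<^bsub>free_act M X\<^esub> m \<in> L}"
  shows "defined_by M (A\<lparr>carrier := B\<rparr>) Y (R1 \<union> R2 \<union> R3)"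
proof -

  \<comment> \<open>Words over \<open>X\<close> and \<open>Y\<close> and the elements they
    represent\<close>
  let ?F = "free_act M X" and ?G = "free_act M Y"
  define \<sigma> where "\<sigma> = pres_congruence M Y (R1 \<union> R2 \<union> R3)"
  define \<pi> where "\<pi> u = \<theta> (pres_congruence M X R `` {u})" for u
  have pres: "presentation M X R"
    using assms(3) by (simp add: defined_via_def)
  then have R: "R \<subseteq> carrier ?F \<times> carrier ?F"
    by (simp add: presentation_def)
  have BY: "Y \<subseteq> B" "\<And>b. b \<in> B \<Longrightarrow> \<exists>y\<in>Y. \<exists>m\<in>carrier M. b = y \<cdot>\<^bsub>A\<^esub> m"
    using assms(5) by (auto simp: generates_def)
  have B: "B \<noteq> {}" "\<And>b m. \<lbrakk>b \<in> B; m \<in> carrier M\<rbrakk> \<Longrightarrow> b \<cdot>\<^bsub>A\<^esub> m \<in> B"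
    using assms(4) by (auto simp: subact_def)
  have Y: "Y \<noteq> {}"
    using B(1) BY(2) by blast
  interpret F: monoid_act M ?F
    using assms(1) pres by (simp add: monoid_act_free_act presentation_def)
  interpret G: monoid_act M ?G
    using assms(1) Y by (rule monoid_act_free_act)
  note \<psi> = assms(7) and \<phi> = assms(10)
  have \<pi>: "\<pi> \<in> act_hom M ?F A"
    using defined_via_hom(1)[OF assms(1,3)] by (simp add: \<pi>_def[abs_def])
  have \<pi>_eq: "\<pi> u = \<pi> v \<longleftrightarrow> (u, v) \<in> pres_congruence M X R"
    if "u \<in> carrier ?F" "v \<in> carrier ?F" for u v
    using defined_via_hom(2)[OF assms(1,3) that] by (simp add: \<pi>_def)
  have L: "u \<in> L \<longleftrightarrow> u \<in> carrier ?F \<and> \<pi> u \<in> B" for u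
    by (auto simp: L_def rep_words_def represents_def \<pi>_def)
  have L_act: "u \<cdot>\<^bsub>?F\<^esub> m \<in> L" if "u \<in> L" "m \<in> carrier M" for u m
    using that by (simp add: L F.act_closed act_hom_act[OF \<pi>] B)
  have \<phi>_closed: "\<phi> u \<in> carrier ?G" if "u \<in> L" for u
    using \<phi> that by blast
  have w: "w y \<in> L" "\<pi> (w y) = y" if "y \<in> Y" for y
    using assms(6)[OF that] that BY(1) by (auto simp: L represents_def \<pi>_def)
  have \<pi>\<psi>\<phi>: "\<pi> (\<psi> (\<phi> u)) = \<pi> u" if "u \<in> L" for u
    using assms(11)[OF that] by (auto simp: holds_in_def represents_def \<pi>_def)
  \<comment> \<open>In \<open>R3\<close> only \<open>um\<close> is required to lie in
    \<open>L\<close>. Both words represent the same element, so \<open>vm\<close> lies in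
    \<open>L\<close> too and \<open>\<phi>\<close> is applied inside its domain.\<close>
  have R_act: "u \<cdot>\<^bsub>?F\<^esub> m \<in> L \<longleftrightarrow> v \<cdot>\<^bsub>?F\<^esub> m \<in> L"
      "\<pi> (u \<cdot>\<^bsub>?F\<^esub> m) = \<pi> (v \<cdot>\<^bsub>?F\<^esub> m)"
    if "(u, v) \<in> R" "m \<in> carrier M" for u v m
  proof -
    have "u \<in> carrier ?F" "v \<in> carrier ?F" "(u, v) \<in> pres_congruence M X R"
      using R F.act_congruence_generated(2)[OF R] that by auto
    then show "u \<cdot>\<^bsub>?F\<^esub> m \<in> L \<longleftrightarrow> v \<cdot>\<^bsub>?F\<^esub> m \<in> L"
      "\<pi> (u \<cdot>\<^bsub>?F\<^esub> m) = \<pi> (v \<cdot>\<^bsub>?F\<^esub> m)"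
      using that \<pi>_eq[of u v] by (simp_all add: L F.act_closed act_hom_act[OF \<pi>])
  qed
  have gen: "free_gen M y \<in> carrier ?G" "free_gen M y \<cdot>\<^bsub>?G\<^esub> m = (y, m)"
    if "y \<in> Y" "m \<in> carrier M" for y m
    using that by (simp_all add: free_gen_def free_act_def)
  \<comment> \<open>The word \<open>(y, m)\<close> is the free generator of \<open>y\<close> acted
    on by \<open>m\<close>.\<close>
  have \<psi>_word: "\<psi> (y, m) = w y \<cdot>\<^bsub>?F\<^esub> m" if "y \<in> Y" "m \<in> carrier M" for y m
    using act_hom_act[OF \<psi> gen(1) that(2), of y] that gen(2) assms(8) by auto
  have \<psi>_L: "\<psi> g \<in> L" if g: "g \<in> carrier ?G" for g
  proof -
    obtain y m where "g = (y, m)" "y \<in> Y" "m \<in> carrier M"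
      using g by (auto simp: free_act_def)
    then show ?thesis by (simp add: \<psi>_word L_act w)
  qed

  \<comment> \<open>The congruence generated by the relations on words over \<open>Y\<close>\<close>
  have S: "R1 \<union> R2 \<union> R3 \<subseteq> carrier ?G \<times> carrier ?G"
  proof -
    have "R1 \<subseteq> carrier ?G \<times> carrier ?G"
      by (auto simp only: R1_def mem_Sigma_iff intro!: \<phi>_closed w gen(1)[OF _ F.one_closed])
    moreover have "R2 \<subseteq> carrier ?G \<times> carrier ?G"
      by (auto simp only: R2_def mem_Sigma_iff intro!: \<phi>_closed L_act G.act_closed)
    moreover have "R3 \<subseteq> carrier ?G \<times> carrier ?G"
    proof (rule subrelI)
      fix g h assume "(g, h) \<in> R3"
      then obtain u v m where "(u, v) \<in> R" "m \<in> carrier M" "u \<cdot>\<^bsub>?F\<^esub> m \<in> L"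
        and "g = \<phi> (u \<cdot>\<^bsub>?F\<^esub> m)" "h = \<phi> (v \<cdot>\<^bsub>?F\<^esub> m)"
        unfolding R3_def by blast
      then show "(g, h) \<in> carrier ?G \<times> carrier ?G"
        by (simp add: \<phi>_closed flip: R_act(1))
    qed
    ultimately show ?thesis by blast
  qed
  have \<sigma>: "act_congruence M ?G \<sigma>" "R1 \<union> R2 \<union> R3 \<subseteq> \<sigma>"
    using G.act_congruence_generated[OF S] by (simp_all add: \<sigma>_def)
  have \<sigma>_equiv: "equiv (carrier ?G) \<sigma>"
    using \<sigma>(1) by (simp add: act_congruence_def)
  then have \<sigma>_refl: "\<And>g. g \<in> carrier ?G \<Longrightarrow> (g, g) \<in> \<sigma>"
    and \<sigma>_sym: "\<And>g h. (g, h) \<in> \<sigma> \<Longrightarrow> (h, g) \<in> \<sigma>"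
    and \<sigma>_trans: "\<And>g h k. \<lbrakk>(g, h) \<in> \<sigma>; (h, k) \<in> \<sigma>\<rbrakk> \<Longrightarrow> (g, k) \<in> \<sigma>"
    by (auto elim!: equivE dest: refl_onD symD transD)

  \<comment> \<open>Congruence of words over \<open>X\<close> carried along
    \<open>\<phi>\<close>\<close>
  define K where "K = {(u, v). u \<in> carrier ?F \<and> v \<in> carrier ?F \<and>
    (\<forall>m\<in>carrier M. (u \<cdot>\<^bsub>?F\<^esub> m \<in> L \<longleftrightarrow> v \<cdot>\<^bsub>?F\<^esub> m \<in> L) \<and>
      (u \<cdot>\<^bsub>?F\<^esub> m \<in> L \<longrightarrow> (\<phi> (u \<cdot>\<^bsub>?F\<^esub> m), \<phi> (v \<cdot>\<^bsub>?F\<^esub> m)) \<in> \<sigma>))}"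
  \<comment> \<open>The implication in \<open>K\<close> is guarded by \<open>u\<close> only; the
    equivalence of memberships transfers the guard to \<open>v\<close>, which gives symmetry and
    transitivity.\<close>
  have "equiv (carrier ?F) K"
  proof (rule equivI)
    show "K \<subseteq> carrier ?F \<times> carrier ?F" by (auto simp: K_def)
    show "refl_on (carrier ?F) K"
      by (auto simp: refl_on_def K_def intro: \<sigma>_refl \<phi>_closed)
    show "sym K" by (auto simp: sym_def K_def intro: \<sigma>_sym)
    show "trans K" unfolding trans_def K_def by (blast intro: \<sigma>_trans)
  qed
  \<comment> \<open>After acting by \<open>n\<close>, the condition at \<open>m\<close> is the
    original one at \<open>n \<otimes> m\<close>; this is why \<open>K\<close> quantifies over all
    \<open>m\<close>.\<close>
  then have "act_congruence M ?F K"
    by (auto simp: act_congruence_def K_def F.act_closed simp flip: F.act_mult)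
  moreover have "R \<subseteq> K"
  proof (rule subrelI)
    fix u v assume uv: "(u, v) \<in> R"
    have "(\<phi> (u \<cdot>\<^bsub>?F\<^esub> m), \<phi> (v \<cdot>\<^bsub>?F\<^esub> m)) \<in> \<sigma>" if "m \<in> carrier M" "u \<cdot>\<^bsub>?F\<^esub> m \<in> L" for m
      using uv that \<sigma>(2) unfolding R3_def by blast
    then show "(u, v) \<in> K"
      using uv R R_act(1)[OF uv] by (auto simp: K_def)
  qed
  ultimately have "pres_congruence M X R \<subseteq> K"
    by (rule generated_congruence_least)
  then have \<phi>_cong: "(\<phi> u, \<phi> v) \<in> \<sigma>" if "u \<in> L" "v \<in> L" "\<pi> u = \<pi> v" for u v
  proof -
    have "u \<in> carrier ?F" "v \<in> carrier ?F"
      using that by (simp_all add: L)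
    then have "(u, v) \<in> K"
      using \<open>pres_congruence M X R \<subseteq> K\<close> \<pi>_eq that(3) by blast
    \<comment> \<open>Taking \<open>m\<close> to be the identity recovers the words
      themselves.\<close>
    then have "u \<cdot>\<^bsub>?F\<^esub> \<one>\<^bsub>M\<^esub> \<in> L \<longrightarrow> (\<phi> (u \<cdot>\<^bsub>?F\<^esub> \<one>\<^bsub>M\<^esub>), \<phi> (v \<cdot>\<^bsub>?F\<^esub> \<one>\<^bsub>M\<^esub>)) \<in> \<sigma>"
      unfolding K_def using F.one_closed by blast
    then show ?thesis
      using that \<open>u \<in> carrier ?F\<close> \<open>v \<in> carrier ?F\<close> by (simp add: F.act_one)
  qed
  \<comment> \<open>For \<open>g = (y, m)\<close>, \<open>R2\<close> moves \<open>m\<close> out of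
    \<open>\<phi> (w y \<cdot> m)\<close>, and \<open>R1\<close>, acted on by \<open>m\<close>,
    replaces \<open>\<phi> (w y)\<close> by the generator.\<close>
  have \<phi>\<psi>: "(\<phi> (\<psi> g), g) \<in> \<sigma>" if G: "g \<in> carrier ?G" for g
  proof -
    obtain y m where g: "g = (y, m)" and y: "y \<in> Y" and m: "m \<in> carrier M"
      using G by (auto simp: free_act_def)
    have "(\<phi> (w y \<cdot>\<^bsub>?F\<^esub> m), \<phi> (w y) \<cdot>\<^bsub>?G\<^esub> m) \<in> \<sigma>"
      using w(1)[OF y] m \<sigma>(2) unfolding R2_def by blast
    moreover have "(\<phi> (w y), free_gen M y) \<in> \<sigma>"
      using y \<sigma>(2) \<sigma>_sym unfolding R1_def by blast
    then have "(\<phi> (w y) \<cdot>\<^bsub>?G\<^esub> m, free_gen M y \<cdot>\<^bsub>?G\<^esub> m) \<in> \<sigma>"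
      using \<sigma>(1) m unfolding act_congruence_def by blast
    ultimately show ?thesis
      using \<sigma>_trans by (simp add: g \<psi>_word gen y m)
  qed

  \<comment> \<open>Evaluation of words over \<open>Y\<close> in \<open>B\<close>, and its
    kernel\<close>
  have hom: "\<pi> \<circ> \<psi> \<in> act_hom M ?G (A\<lparr>carrier := B\<rparr>)"
    using act_hom_comp[OF \<psi> \<pi>] \<psi>_L by (auto simp: act_hom_def L)
  show ?thesis
  proof (rule defined_by_kernelI[OF assms(1) _ hom])
    show "presentation M Y (R1 \<union> R2 \<union> R3)"
      using Y S by (simp add: presentation_def)
    have "b \<in> (\<pi> \<circ> \<psi>) ` carrier ?G" if "b \<in> B" for b
    proof -
      obtain y m where y: "y \<in> Y" and m: "m \<in> carrier M" and b: "b = y \<cdot>\<^bsub>A\<^esub> m"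
        using BY(2)[OF \<open>b \<in> B\<close>] by blast
      have "w y \<in> carrier ?F"
        using w(1)[OF y] by (simp add: L)
      \<comment> \<open>\<open>\<psi>\<close> sends \<open>(y, m)\<close> to
        \<open>w y \<cdot> m\<close>, whose value is \<open>y \<cdot> m\<close> because
        \<open>w y\<close> represents \<open>y\<close>.\<close>
      then have "b = (\<pi> \<circ> \<psi>) (y, m)"
        using y m b by (simp add: \<psi>_word act_hom_act[OF \<pi>] w)
      then show ?thesis
        using y m by (auto simp: free_act_def)
    qed
    then show "(\<pi> \<circ> \<psi>) ` carrier ?G = carrier (A\<lparr>carrier := B\<rparr>)"
      using \<psi>_L by (auto simp: L)
    show "(\<pi> \<circ> \<psi>) g = (\<pi> \<circ> \<psi>) h" if "(g, h) \<in> R1 \<union> R2 \<union> R3" for g h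
      using that
    proof (elim UnE)
      \<comment> \<open>Both sides evaluate to \<open>y\<close>.\<close>
      assume "(g, h) \<in> R1"
      then show ?thesis
        using w assms(8) by (auto simp: R1_def \<pi>\<psi>\<phi>)
    next
      \<comment> \<open>Both sides evaluate to \<open>\<pi> u \<cdot> m\<close>: on the left
        \<open>\<pi>\<psi>\<phi>\<close> is used at \<open>um\<close>, on the right at
        \<open>u\<close> after moving \<open>m\<close> outside.\<close>
      assume "(g, h) \<in> R2"
      then obtain u m where "g = \<phi> (u \<cdot>\<^bsub>?F\<^esub> m)" "h = \<phi> u \<cdot>\<^bsub>?G\<^esub> m"
        and u: "u \<in> L" and m: "m \<in> carrier M"
        unfolding R2_def by blast
      moreover have "u \<in> carrier ?F" "\<psi> (\<phi> u) \<in> carrier ?F"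
        using u \<psi>_L[OF \<phi>_closed[OF u]] by (simp_all add: L)
      ultimately show ?thesis
        by (simp add: \<pi>\<psi>\<phi> L_act \<phi>_closed act_hom_act[OF \<psi>] act_hom_act[OF \<pi>])
    next
      assume "(g, h) \<in> R3"
      then obtain u v m where gh: "g = \<phi> (u \<cdot>\<^bsub>?F\<^esub> m)" "h = \<phi> (v \<cdot>\<^bsub>?F\<^esub> m)"
        and uv: "(u, v) \<in> R" "m \<in> carrier M" and "u \<cdot>\<^bsub>?F\<^esub> m \<in> L"
        unfolding R3_def by blast
      moreover have "v \<cdot>\<^bsub>?F\<^esub> m \<in> L"
        using \<open>u \<cdot>\<^bsub>?F\<^esub> m \<in> L\<close> R_act(1)[OF uv] by simp
      ultimately show ?thesis
        using R_act(2)[OF uv] by (simp add: \<pi>\<psi>\<phi>)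
    qed
    show "(g, h) \<in> pres_congruence M Y (R1 \<union> R2 \<union> R3)"
      if "g \<in> carrier ?G" "h \<in> carrier ?G" "(\<pi> \<circ> \<psi>) g = (\<pi> \<circ> \<psi>) h" for g h
    proof -
      \<comment> \<open>The chain is \<open>g\<close>, \<open>\<phi> (\<psi> g)\<close>,
        \<open>\<phi> (\<psi> h)\<close>, \<open>h\<close>; the middle link uses that
        \<open>\<psi> g\<close> and \<open>\<psi> h\<close> represent the same element.\<close>
      have "(\<phi> (\<psi> g), \<phi> (\<psi> h)) \<in> \<sigma>"
        using that by (intro \<phi>_cong \<psi>_L) simp_all
      then have "(g, h) \<in> \<sigma>"
        using \<sigma>_trans[OF \<sigma>_trans[OF \<sigma>_sym[OF \<phi>\<psi>] _] \<phi>\<psi>] that by blast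
      then show ?thesis by (simp add: \<sigma>_def)
    qed
  qed
qed

end
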